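(* Let $X$ be an almost isometric ideal in a Banach space $Y$. If $Y$ has the diameter 2 property, then so does $X$.
   Context: All Banach spaces are real. A Banach space $Z$ has the diameter 2 property if every non-empty relatively weakly open subset of its closed unit ball $B_Z$ has diameter 2. (In the claim $X$ is itself regarded as a Banach space.) A subspace $X$ of a Banach space $Y$ is an almost isometric ideal (ai-ideal) in $Y$ if for every $\varepsilon>0$ and every finite-dimensional subspace $E\subset Y$ there exists a linear operator $T:E\to X$ such that $Te=e$ for all $e\in X\cap E$ and $(1+\varepsilon)^{-1}\|e\|\le\|Te\|\le(1+\varepsilon)\|e\|$ for all $e\in E$. *)

theory Defs
  imports "HOL-Analysis.Analysis"
begin

definition linear_map_on :: "'a::real_vector set \<Rightarrow> ('a \<Rightarrow> 'b::real_vector) \<Rightarrow> bool" where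
  "linear_map_on S T \<longleftrightarrow>
     (\<forall>x\<in>S. \<forall>y\<in>S. T (x + y) = T x + T y) \<and> (\<forall>c. \<forall>x\<in>S. T (c *\<^sub>R x) = c *\<^sub>R T x)"

(* A Banach space is represented by a subspace Z of an ambient normed space, with Z = UNIV giving
   the whole space. The functionals and the weak topology are those of Z itself. The values of a
   functional outside Z are irrelevant. *)

definition dual_on :: "'a::real_normed_vector set \<Rightarrow> ('a \<Rightarrow> real) set" where
  "dual_on Z = {f. linear_map_on Z f \<and> continuous_on Z f}"

definition weak_topology_on :: "'a::real_normed_vector set \<Rightarrow> 'a topology" where
  "weak_topology_on Z = topology_generated_by {{x \<in> Z. f x \<in> U} | f U. f \<in> dual_on Z \<and> open U}"

definition diameter_2_property :: "'a::real_normed_vector set \<Rightarrow> bool" where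
  "diameter_2_property Z \<longleftrightarrow>
     (\<forall>W. openin (subtopology (weak_topology_on Z) (Z \<inter> cball 0 1)) W \<and> W \<noteq> {} \<longrightarrow> diameter W = 2)"

(* ai_ideal X: X is an almost isometric ideal in its ambient space, i.e. Y = UNIV. The
   finite-dimensional subspaces E are given as the spans of finite sets. *)

definition ai_ideal :: "'a::real_normed_vector set \<Rightarrow> bool" where
  "ai_ideal X \<longleftrightarrow> subspace X \<and>
     (\<forall>\<epsilon>>0. \<forall>E. (\<exists>B. finite B \<and> E = span B) \<longrightarrow>
        (\<exists>T. linear_map_on E T \<and> T ` E \<subseteq> X \<and> (\<forall>e \<in> X \<inter> E. T e = e) \<and>
             (\<forall>e\<in>E. inverse (1 + \<epsilon>) * norm e \<le> norm (T e) \<and> norm (T e) \<le> (1 + \<epsilon>) * norm e)))"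

lemma dual_on_UNIV: "dual_on (UNIV :: 'a::real_normed_vector set) = Collect bounded_linear"
proof -
  have "bounded_linear f" if f: "linear_map_on UNIV f" "continuous_on UNIV f" for f :: "'a \<Rightarrow> real"
  proof -
    have lin: "linear f"
      using f(1) by (auto simp: linear_map_on_def intro: linearI)
    obtain d where d: "d > 0" "\<And>x. dist x 0 < d \<Longrightarrow> dist (f x) (f 0) < 1"
      using f(2) unfolding continuous_on_iff by (metis UNIV_I zero_less_one)
    have "norm (f x) \<le> norm x * (2 / d)" for x
    proof (cases "x = 0")
      case True then show ?thesis using lin by (simp add: linear_0)
    next
      case False
      define c where "c = d / (2 * norm x)"
      have c: "c > 0" using False d(1) by (simp add: c_def)
      have "dist (c *\<^sub>R x) 0 < d" using False d(1) c by (simp add: c_def)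
      then have "\<bar>c * f x\<bar> < 1"
        using d(2)[of "c *\<^sub>R x"] lin by (simp add: linear_0 linear_scale dist_norm)
      then have "c * \<bar>f x\<bar> < 1" using c by (simp add: abs_mult)
      then have "\<bar>f x\<bar> \<le> 1 / c" using c by (simp add: field_simps)
      then show ?thesis by (simp add: c_def mult.commute)
    qed
    then show ?thesis
      using lin unfolding bounded_linear_def bounded_linear_axioms_def by blast
  qed
  moreover have "linear_map_on UNIV f \<and> continuous_on UNIV f" if "bounded_linear f" for f :: "'a \<Rightarrow> real"
    using that bounded_linear.linear[OF that]
    by (auto simp: linear_map_on_def linear_add linear_scale linear_continuous_on)
  ultimately show ?thesis by (auto simp: dual_on_def)
qed

lemma topspace_weak_topology_on: "topspace (weak_topology_on Z) = Z"
proof -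
  have "(\<lambda>x. 0) \<in> dual_on Z" by (simp add: dual_on_def linear_map_on_def)
  then have "Z \<in> {{x \<in> Z. f x \<in> U} | f U. f \<in> dual_on Z \<and> open U}"
    by (intro CollectI exI[of _ "\<lambda>x. 0"] exI[of _ UNIV]) auto
  then show ?thesis unfolding weak_topology_on_def topology_generated_by_topspace by auto
qed

end

theory Submission
  imports Defs
begin

text \<open>The diameter of a relatively weakly open subset of the ball of \<open>X\<close> has to be bounded below by
  means of relatively weakly open subsets of the ball of the ambient space \<open>Y\<close>.  This needs a way
  to pull functionals on \<open>X\<close> back to \<open>Y\<close> which is compatible with the local almost isometries
  \<open>T : E \<rightarrow> X\<close> of the ideal.  If \<open>T\<close> is chosen for every finite-dimensional \<open>E\<close>, a functional \<open>f\<close>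
  on \<open>X\<close> yields the net \<open>f \<circ> T\<close>, which is pointwise bounded; by Tychonoff's theorem these nets have
  a joint cluster point \<open>\<Phi>\<close> for all \<open>f\<close> simultaneously (\<open>ai_ideal_pullback\<close>).  Each
  \<open>\<Phi> f\<close> is a bounded linear extension of \<open>f\<close>, and the cluster point property says that on any
  finite set of vectors some almost isometry \<open>T\<close> satisfies \<open>f (T y) \<approx> \<Phi> f y\<close> for finitely many \<open>f\<close>.

  A weakly open \<open>W\<close> contains the points of the ball of \<open>X\<close> on which finitely many functionals \<open>f\<close>
  are close to their values at some \<open>x0 \<in> W\<close>.  The same inequalities with \<open>\<Phi> f\<close> in place of \<open>f\<close>
  define a relatively weakly open set in the ball of \<open>Y\<close>, which contains \<open>x0\<close> and hence two points
  \<open>y1, y2\<close> at distance almost 2.  The points \<open>T y1 / (1 + e)\<close> and \<open>T y2 / (1 + e)\<close> then lie in \<open>W\<close>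
  and are still almost 2 apart.\<close>

section \<open>Weak neighbourhoods\<close>

lemma linear_map_on_dual:
  assumes "f \<in> dual_on Z"
  shows "x \<in> Z \<Longrightarrow> y \<in> Z \<Longrightarrow> f (x + y) = f x + f y" "x \<in> Z \<Longrightarrow> f (c *\<^sub>R x) = c * f x"
  using assms by (auto simp: dual_on_def linear_map_on_def)

lemma dual_on_bounded:
  assumes f: "f \<in> dual_on Z" and Z: "subspace Z"
  obtains C where "C > 0" "\<And>x. x \<in> Z \<Longrightarrow> \<bar>f x\<bar> \<le> C * norm x"
proof -
  have f0: "f 0 = 0"
    using linear_map_on_dual(2)[OF f, of 0 0] subspace_0[OF Z] by simp
  have "continuous_on Z f" using f by (simp add: dual_on_def)
  then obtain d where d: "d > 0" "\<And>x. x \<in> Z \<Longrightarrow> dist x 0 < d \<Longrightarrow> dist (f x) (f 0) < 1"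
    using subspace_0[OF Z] unfolding continuous_on_iff by (metis zero_less_one)
  have "\<bar>f x\<bar> \<le> 2 / d * norm x" if x: "x \<in> Z" for x
  proof (cases "x = 0")
    case True
    then show ?thesis by (simp add: f0)
  next
    case False
    define c where "c = d / (2 * norm x)"
    have c: "c > 0" using False d(1) by (simp add: c_def)
    have "c *\<^sub>R x \<in> Z" using x Z by (simp add: subspace_scale)
    moreover have "dist (c *\<^sub>R x) 0 < d" using False d(1) c by (simp add: c_def)
    ultimately have "\<bar>c * f x\<bar> < 1"
      using d(2)[of "c *\<^sub>R x"] linear_map_on_dual(2)[OF f x] by (simp add: f0 dist_norm)
    then have "c * \<bar>f x\<bar> < 1" using c by (simp add: abs_mult)
    then have "\<bar>f x\<bar> \<le> 1 / c" using c by (simp add: field_simps)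
    then show ?thesis by (simp add: c_def)
  qed
  then show thesis using d(1) by (intro that[of "2 / d"]) auto
qed

lemma dual_on_uniformly_bounded:
  assumes "finite F" "F \<subseteq> dual_on Z" and Z: "subspace Z"
  shows "\<exists>C>0. \<forall>f\<in>F. \<forall>x\<in>Z. \<bar>f x\<bar> \<le> C * norm x"
  using assms(1,2)
proof (induction rule: finite_induct)
  case empty
  show ?case by (intro exI[of _ 1]) simp
next
  case (insert g F)
  then obtain C where C: "C > 0" "\<forall>f\<in>F. \<forall>x\<in>Z. \<bar>f x\<bar> \<le> C * norm x" by auto
  obtain D where D: "D > 0" "\<And>x. x \<in> Z \<Longrightarrow> \<bar>g x\<bar> \<le> D * norm x"
    using dual_on_bounded[OF _ Z, of g] insert.prems by blast
  have "\<bar>f x\<bar> \<le> (C + D) * norm x" if f: "f \<in> insert g F" and x: "x \<in> Z" for f x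
  proof -
    have "0 \<le> C * norm x" "0 \<le> D * norm x" using C(1) D(1) by simp_all
    moreover have "\<bar>f x\<bar> \<le> C * norm x \<or> \<bar>f x\<bar> \<le> D * norm x" using f x C(2) D(2) by blast
    ultimately show ?thesis by (auto simp: distrib_right)
  qed
  then show ?case using C(1) D(1) by (intro exI[of _ "C + D"]) auto
qed

lemma weak_topology_on_basic_neighbourhood:
  assumes "openin (weak_topology_on Z) V" "x \<in> V"
  obtains F \<delta> where "finite F" "F \<subseteq> dual_on Z" "\<delta> > 0"
    "{z \<in> Z. \<forall>f\<in>F. \<bar>f z - f x\<bar> < \<delta>} \<subseteq> V"
proof -
  let ?S = "{{x \<in> Z. f x \<in> U} | f U. f \<in> dual_on Z \<and> open U}"
  have "generate_topology_on ?S V"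
    using assms(1) by (simp add: weak_topology_on_def openin_topology_generated_by_iff)
  then have "x \<in> V \<Longrightarrow> \<exists>F \<delta>. finite F \<and> F \<subseteq> dual_on Z \<and> \<delta> > 0 \<and>
      {z \<in> Z. \<forall>f\<in>F. \<bar>f z - f x\<bar> < \<delta>} \<subseteq> V"
  proof (induction rule: generate_topology_on.induct)
    case Empty
    then show ?case by simp
  next
    case (Int a b)
    from Int.prems have xa: "x \<in> a" and xb: "x \<in> b" by auto
    obtain F \<delta> where "finite F" "F \<subseteq> dual_on Z" "\<delta> > 0"
      "{z \<in> Z. \<forall>f\<in>F. \<bar>f z - f x\<bar> < \<delta>} \<subseteq> a"
      using Int.IH(1)[OF xa] by (elim exE conjE)
    moreover obtain F' \<delta>' where "finite F'" "F' \<subseteq> dual_on Z" "\<delta>' > 0"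
      "{z \<in> Z. \<forall>f\<in>F'. \<bar>f z - f x\<bar> < \<delta>'} \<subseteq> b"
      using Int.IH(2)[OF xb] by (elim exE conjE)
    ultimately show ?case
      by (intro exI[of _ "F \<union> F'"] exI[of _ "min \<delta> \<delta>'"]) auto
  next
    case (UN K)
    then obtain k where k: "k \<in> K" "x \<in> k" by blast
    obtain F \<delta> where "finite F" "F \<subseteq> dual_on Z" "\<delta> > 0"
      "{z \<in> Z. \<forall>f\<in>F. \<bar>f z - f x\<bar> < \<delta>} \<subseteq> k"
      using UN.IH[OF k] by (elim exE conjE)
    moreover have "k \<subseteq> \<Union>K" using k by blast
    ultimately show ?case by (intro exI[of _ F] exI[of _ \<delta>]) simp
  next
    case (Basis s)
    then obtain f U where s: "s = {z \<in> Z. f z \<in> U}" "f \<in> dual_on Z" "open U" by blast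
    then obtain \<delta> where "\<delta> > 0" "\<And>t. dist t (f x) < \<delta> \<Longrightarrow> t \<in> U"
      using Basis.prems by (auto simp: open_dist)
    then show ?case
      using s by (intro exI[of _ "{f}"] exI[of _ \<delta>]) (auto simp: dist_real_def)
  qed
  then show thesis using assms(2) that by blast
qed

lemma openin_weak_topology_on_basic:
  assumes "finite F" "F \<subseteq> dual_on Z"
  shows "openin (weak_topology_on Z) {z \<in> Z. \<forall>f\<in>F. \<bar>f z - a f\<bar> < \<delta>}"
  using assms
proof (induction rule: finite_induct)
  case empty
  show ?case using openin_topspace[of "weak_topology_on Z"] by (simp add: topspace_weak_topology_on)
next
  case (insert g F)
  have "openin (weak_topology_on Z) {z \<in> Z. g z \<in> ball (a g) \<delta>}"
    unfolding weak_topology_on_def using insert.prems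
    by (intro topology_generated_by_Basis) blast
  with insert have "openin (weak_topology_on Z)
      ({z \<in> Z. g z \<in> ball (a g) \<delta>} \<inter> {z \<in> Z. \<forall>f\<in>F. \<bar>f z - a f\<bar> < \<delta>})"
    by (intro openin_Int) auto
  also have "{z \<in> Z. g z \<in> ball (a g) \<delta>} \<inter> {z \<in> Z. \<forall>f\<in>F. \<bar>f z - a f\<bar> < \<delta>} =
      {z \<in> Z. \<forall>f\<in>insert g F. \<bar>f z - a f\<bar> < \<delta>}"
    by (auto simp: dist_real_def abs_minus_commute)
  finally show ?case .
qed

section \<open>Pulling functionals back along the local almost isometries\<close>

text \<open>Tychonoff's theorem, in the form in which it replaces convergence along an ultrafilter: the
  values on any finite set of coordinates are approximated by members that occur frequently.\<close>

lemma pointwise_cluster_point: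
  fixes g :: "'i \<Rightarrow> 'p \<Rightarrow> real"
  assumes F: "F \<noteq> bot" and bound: "\<And>i p. \<bar>g i p\<bar> \<le> M p"
  obtains \<phi> where "\<And>P A \<epsilon>. \<lbrakk>eventually P F; finite A; \<epsilon> > 0\<rbrakk> \<Longrightarrow> \<exists>i. P i \<and> (\<forall>p\<in>A. \<bar>g i p - \<phi> p\<bar> < \<epsilon>)"
proof -
  define K where "K = Pi\<^sub>E UNIV (\<lambda>p. {- M p..M p})"
  have "compactin (product_topology (\<lambda>_. euclidean) UNIV) K"
    unfolding K_def by (simp add: compactin_PiE)
  then have "compact K" by (simp add: euclidean_product_topology)
  moreover have "filtermap g F \<noteq> bot" using F by (simp add: filtermap_bot_iff)
  moreover have "g i \<in> K" for i
    using bound[of i] by (auto simp: K_def abs_le_iff minus_le_iff)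
  then have "eventually (\<lambda>h. h \<in> K) (filtermap g F)"
    by (simp add: eventually_filtermap)
  ultimately obtain \<phi> where \<phi>: "inf (nhds \<phi>) (filtermap g F) \<noteq> bot"
    unfolding compact_filter by blast
  show thesis
  proof (rule that[of \<phi>])
    fix P and A :: "'p set" and \<epsilon> :: real
    assume P: "eventually P F" and A: "finite A" and \<epsilon>: "\<epsilon> > 0"
    have "eventually (\<lambda>h. \<bar>h p - \<phi> p\<bar> < \<epsilon>) (nhds \<phi>)" for p
    proof -
      have "open ((\<lambda>h :: 'p \<Rightarrow> real. h p) -` ball (\<phi> p) \<epsilon>)"
        by (intro open_vimage) auto
      then have "eventually (\<lambda>h. h \<in> (\<lambda>h. h p) -` ball (\<phi> p) \<epsilon>) (nhds \<phi>)"
        using \<epsilon> by (intro eventually_nhds_in_open) auto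
      then show ?thesis by (simp add: dist_real_def abs_minus_commute)
    qed
    then have "eventually (\<lambda>h. \<forall>p\<in>A. \<bar>h p - \<phi> p\<bar> < \<epsilon>) (nhds \<phi>)"
      using A by (simp add: eventually_ball_finite)
    moreover have "eventually (\<lambda>h. \<exists>i. h = g i \<and> P i) (filtermap g F)"
      using P by (auto simp: eventually_filtermap elim: eventually_mono)
    ultimately have "eventually (\<lambda>h. \<exists>i. P i \<and> (\<forall>p\<in>A. \<bar>g i p - \<phi> p\<bar> < \<epsilon>)) (inf (nhds \<phi>) (filtermap g F))"
      unfolding eventually_inf by blast
    then show "\<exists>i. P i \<and> (\<forall>p\<in>A. \<bar>g i p - \<phi> p\<bar> < \<epsilon>)"
      using \<phi> by (auto simp: eventually_const_iff)
  qed
qed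

definition local_almost_isometry :: "'a::real_normed_vector set \<Rightarrow> 'a set \<Rightarrow> real \<Rightarrow> ('a \<Rightarrow> 'a) \<Rightarrow> bool" where
  "local_almost_isometry X E \<epsilon> T \<longleftrightarrow> linear_map_on E T \<and> T ` E \<subseteq> X \<and> (\<forall>e \<in> X \<inter> E. T e = e) \<and>
     (\<forall>e\<in>E. inverse (1 + \<epsilon>) * norm e \<le> norm (T e) \<and> norm (T e) \<le> (1 + \<epsilon>) * norm e)"

lemma local_almost_isometry_mono:
  assumes T: "local_almost_isometry X E' \<epsilon>' T" and "E \<subseteq> E'" "0 < \<epsilon>'" "\<epsilon>' \<le> \<epsilon>"
  shows "local_almost_isometry X E \<epsilon> T"
proof -
  have "inverse (1 + \<epsilon>) * norm e \<le> norm (T e) \<and> norm (T e) \<le> (1 + \<epsilon>) * norm e" if "e \<in> E" for e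
  proof -
    have "inverse (1 + \<epsilon>) * norm e \<le> inverse (1 + \<epsilon>') * norm e"
      using assms by (intro mult_right_mono le_imp_inverse_le) auto
    moreover have "(1 + \<epsilon>') * norm e \<le> (1 + \<epsilon>) * norm e"
      using assms by (intro mult_right_mono) auto
    moreover have "inverse (1 + \<epsilon>') * norm e \<le> norm (T e) \<and> norm (T e) \<le> (1 + \<epsilon>') * norm e"
      using that assms unfolding local_almost_isometry_def by blast
    ultimately show ?thesis by linarith
  qed
  then show ?thesis
    using T \<open>E \<subseteq> E'\<close> unfolding local_almost_isometry_def linear_map_on_def by blast
qed

text \<open>The net is indexed by the finite sets \<open>B\<close> together with the tolerances \<open>1 / (n + 1)\<close>; the
  coordinates are the pairs of a functional and a vector, so that a single cluster point serves all
  functionals at once.  A tail of the net consists of maps whose domain contains the given \<open>A\<close>.\<close>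

lemma ai_ideal_cluster_functionals:
  assumes X: "ai_ideal X"
  obtains \<Phi> :: "('a::real_normed_vector \<Rightarrow> real) \<Rightarrow> 'a \<Rightarrow> real" where
    "\<And>A F \<epsilon>. \<lbrakk>finite A; finite F; F \<subseteq> dual_on X; \<epsilon> > 0\<rbrakk> \<Longrightarrow>
       \<exists>T. local_almost_isometry X (span A) \<epsilon> T \<and> (\<forall>f\<in>F. \<forall>y\<in>A. \<bar>f (T y) - \<Phi> f y\<bar> < \<epsilon>)"
proof -
  have sub: "subspace X" using X by (simp add: ai_ideal_def)
  have "\<exists>T. local_almost_isometry X (span B) (1 / real (Suc n)) T" if "finite B" for B n
    using X that unfolding ai_ideal_def local_almost_isometry_def
    by (metis of_nat_0_less_iff zero_less_Suc zero_less_divide_1_iff)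
  then obtain T where T: "\<And>B n. finite B \<Longrightarrow> local_almost_isometry X (span B) (1 / real (Suc n)) (T B n)"
    by metis
  have "\<exists>C. f \<in> dual_on X \<longrightarrow> C > 0 \<and> (\<forall>x\<in>X. \<bar>f x\<bar> \<le> C * norm x)" for f
    using dual_on_bounded[OF _ sub] by metis
  then obtain C where C: "\<And>f. f \<in> dual_on X \<Longrightarrow> C f > 0"
    "\<And>f x. f \<in> dual_on X \<Longrightarrow> x \<in> X \<Longrightarrow> \<bar>f x\<bar> \<le> C f * norm x" by metis
  \<comment> \<open>Outside their domains the maps \<open>f \<circ> T\<close> are set to 0, which keeps the bound below uniform.\<close>
  define g where "g = (\<lambda>(B, n) (f, y). if finite B \<and> y \<in> span B \<and> f \<in> dual_on X
                                         then f (T B n y) else 0)"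
  define M where "M = (\<lambda>(f, y :: 'a). \<bar>C f\<bar> * (2 * norm y))"
  have "\<bar>g i p\<bar> \<le> M p" for i p
  proof -
    obtain B n f y where ip: "i = (B, n)" "p = (f, y)" by (metis surj_pair)
    show ?thesis
    proof (cases "finite B \<and> y \<in> span B \<and> f \<in> dual_on X")
      case True
      then have TX: "T B n y \<in> X" and "norm (T B n y) \<le> (1 + 1 / real (Suc n)) * norm y"
        using T[of B n] by (auto simp: local_almost_isometry_def)
      moreover have "(1 + 1 / real (Suc n)) * norm y \<le> 2 * norm y"
        by (intro mult_right_mono) auto
      ultimately have "C f * norm (T B n y) \<le> C f * (2 * norm y)"
        using C(1)[of f] True by (intro mult_left_mono) auto
      moreover have "\<bar>f (T B n y)\<bar> \<le> C f * norm (T B n y)"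
        using True TX C(2) by blast
      ultimately have "\<bar>f (T B n y)\<bar> \<le> C f * (2 * norm y)"
        by linarith
      then show ?thesis
        using True C(1)[of f] by (simp add: ip g_def M_def)
    qed (auto simp: ip g_def M_def)
  qed
  moreover have "finite_subsets_at_top UNIV \<times>\<^sub>F sequentially \<noteq> bot"
    by (simp add: prod_filter_eq_bot)
  ultimately obtain \<phi> where \<phi>: "\<And>P A \<epsilon>. \<lbrakk>eventually P (finite_subsets_at_top UNIV \<times>\<^sub>F sequentially);
      finite A; \<epsilon> > 0\<rbrakk> \<Longrightarrow> \<exists>i. P i \<and> (\<forall>p\<in>A. \<bar>g i p - \<phi> p\<bar> < \<epsilon>)"
    using pointwise_cluster_point[of "finite_subsets_at_top UNIV \<times>\<^sub>F sequentially" g M] by metis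
  show thesis
  proof (rule that[of "curry \<phi>"])
    fix A :: "'a set" and F and \<epsilon> :: real
    assume A: "finite A" and F: "finite F" "F \<subseteq> dual_on X" and \<epsilon>: "\<epsilon> > 0"
    obtain N where N: "1 / real (Suc N) < \<epsilon>"
      using \<epsilon> reals_Archimedean by (metis inverse_eq_divide)
    have "eventually (\<lambda>B. finite B \<and> A \<subseteq> B) (finite_subsets_at_top UNIV)"
      using A by (auto simp: eventually_finite_subsets_at_top)
    then have "eventually (\<lambda>(B, n). finite B \<and> A \<subseteq> B \<and> n \<ge> N) (finite_subsets_at_top UNIV \<times>\<^sub>F sequentially)"
      using eventually_ge_at_top[of N] unfolding eventually_prod_filter by fast
    then have "\<exists>i. (case i of (B, n) \<Rightarrow> finite B \<and> A \<subseteq> B \<and> n \<ge> N) \<and>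
        (\<forall>p\<in>F \<times> A. \<bar>g i p - \<phi> p\<bar> < \<epsilon>)"
      using A F(1) \<epsilon> by (intro \<phi>) auto
    then obtain B n where B: "finite B" "A \<subseteq> B" "n \<ge> N"
      and close: "\<And>f y. f \<in> F \<Longrightarrow> y \<in> A \<Longrightarrow> \<bar>g (B, n) (f, y) - \<phi> (f, y)\<bar> < \<epsilon>"
      by auto
    have "1 / real (Suc n) \<le> 1 / real (Suc N)" using B(3) by (intro divide_left_mono) auto
    then have "local_almost_isometry X (span A) \<epsilon> (T B n)"
      using B N by (intro local_almost_isometry_mono[OF T[of B n]] span_mono) auto
    moreover have "\<bar>f (T B n y) - curry \<phi> f y\<bar> < \<epsilon>" if "f \<in> F" "y \<in> A" for f y
    proof -
      have "y \<in> span B" "f \<in> dual_on X" using that B F by (auto intro: span_base)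
      then show ?thesis using close[OF that] B(1) by (simp add: g_def)
    qed
    ultimately show "\<exists>T. local_almost_isometry X (span A) \<epsilon> T \<and> (\<forall>f\<in>F. \<forall>y\<in>A. \<bar>f (T y) - curry \<phi> f y\<bar> < \<epsilon>)"
      by blast
  qed
qed

lemma real_eq_if_arbitrarily_close:
  fixes a b :: real
  assumes "\<And>\<epsilon>. \<epsilon> > 0 \<Longrightarrow> \<bar>a - b\<bar> \<le> \<epsilon>"
  shows "a = b"
  using field_le_epsilon[of "\<bar>a - b\<bar>" 0] assms by simp

text \<open>The approximation property alone forces \<open>\<Phi> f\<close> to be a continuous linear extension of \<open>f\<close>:
  each of these is a condition on finitely many values, which \<open>f \<circ> T\<close> satisfies as soon as they lie
  in the domain of \<open>T\<close>.  Continuity comes from the bound \<open>2 * C * norm y\<close>, where \<open>C\<close> bounds \<open>f\<close> and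
  the factor 2 is room for the distortion of \<open>T\<close>.\<close>

lemma ai_ideal_pullback:
  fixes X :: "'a::real_normed_vector set"
  assumes X: "ai_ideal X"
  shows "\<exists>\<Phi>. (\<forall>f\<in>dual_on X. \<Phi> f \<in> dual_on UNIV \<and> (\<forall>x\<in>X. \<Phi> f x = f x)) \<and>
    (\<forall>A F. \<forall>\<epsilon>>0. finite A \<longrightarrow> finite F \<longrightarrow> F \<subseteq> dual_on X \<longrightarrow>
       (\<exists>T. local_almost_isometry X (span A) \<epsilon> T \<and> (\<forall>f\<in>F. \<forall>y\<in>A. \<bar>f (T y) - \<Phi> f y\<bar> < \<epsilon>)))"
proof -
  have sub: "subspace X" using X by (simp add: ai_ideal_def)
  obtain \<Phi> :: "('a \<Rightarrow> real) \<Rightarrow> 'a \<Rightarrow> real" where \<Phi>: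
    "\<And>A F \<epsilon>. \<lbrakk>finite A; finite F; F \<subseteq> dual_on X; \<epsilon> > 0\<rbrakk> \<Longrightarrow>
       \<exists>T. local_almost_isometry X (span A) \<epsilon> T \<and> (\<forall>f\<in>F. \<forall>y\<in>A. \<bar>f (T y) - \<Phi> f y\<bar> < \<epsilon>)"
    using ai_ideal_cluster_functionals[OF X] by metis
  have dual: "\<Phi> f \<in> dual_on UNIV" and ext: "\<And>x. x \<in> X \<Longrightarrow> \<Phi> f x = f x" if f: "f \<in> dual_on X" for f
  proof -
    have approx: "\<exists>T. local_almost_isometry X (span A) \<epsilon> T \<and> (\<forall>y\<in>A. \<bar>f (T y) - \<Phi> f y\<bar> < \<epsilon>)"
      if "finite A" "\<epsilon> > 0" for A \<epsilon>
      using \<Phi>[of A "{f}" \<epsilon>] that f by auto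
    show "\<Phi> f x = f x" if x: "x \<in> X" for x
    proof -
      have "\<bar>\<Phi> f x - f x\<bar> \<le> \<epsilon>" if "\<epsilon> > 0" for \<epsilon>
      proof -
        obtain T where "local_almost_isometry X (span {x}) \<epsilon> T" "\<bar>f (T x) - \<Phi> f x\<bar> < \<epsilon>"
          using approx[of "{x}" \<epsilon>] \<open>\<epsilon> > 0\<close> by auto
        moreover from this have "T x = x"
          using x by (auto simp: local_almost_isometry_def span_base)
        ultimately show ?thesis by auto
      qed
      then show ?thesis by (rule real_eq_if_arbitrarily_close)
    qed
    have add: "\<Phi> f (y + z) = \<Phi> f y + \<Phi> f z" for y z
    proof -
      have "\<bar>\<Phi> f (y + z) - (\<Phi> f y + \<Phi> f z)\<bar> \<le> \<epsilon>" if "\<epsilon> > 0" for \<epsilon>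
      proof -
        let ?A = "{y, z, y + z}"
        obtain T where T: "local_almost_isometry X (span ?A) (\<epsilon> / 3) T"
          and close: "\<forall>v\<in>?A. \<bar>f (T v) - \<Phi> f v\<bar> < \<epsilon> / 3"
          using approx[of ?A "\<epsilon> / 3"] \<open>\<epsilon> > 0\<close> by auto
        have yz: "y \<in> span ?A" "z \<in> span ?A" by (auto intro: span_base)
        then have "T (y + z) = T y + T z" "T y \<in> X" "T z \<in> X"
          using T unfolding local_almost_isometry_def linear_map_on_def by blast+
        then have "f (T (y + z)) = f (T y) + f (T z)"
          using linear_map_on_dual(1)[OF f] by simp
        moreover have "\<bar>f (T y) - \<Phi> f y\<bar> < \<epsilon> / 3" "\<bar>f (T z) - \<Phi> f z\<bar> < \<epsilon> / 3"
          "\<bar>f (T (y + z)) - \<Phi> f (y + z)\<bar> < \<epsilon> / 3"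
          using close by blast+
        ultimately show ?thesis by linarith
      qed
      then show ?thesis by (rule real_eq_if_arbitrarily_close)
    qed
    have scale: "\<Phi> f (c *\<^sub>R y) = c * \<Phi> f y" for c y
    proof -
      have "\<bar>\<Phi> f (c *\<^sub>R y) - c * \<Phi> f y\<bar> \<le> \<epsilon>" if "\<epsilon> > 0" for \<epsilon>
      proof -
        let ?A = "{y, c *\<^sub>R y}"
        define d where "d = \<epsilon> / (1 + \<bar>c\<bar>)"
        have d: "d > 0" "(1 + \<bar>c\<bar>) * d = \<epsilon>" using \<open>\<epsilon> > 0\<close> by (auto simp: d_def field_simps)
        obtain T where T: "local_almost_isometry X (span ?A) d T"
          and close: "\<forall>v\<in>?A. \<bar>f (T v) - \<Phi> f v\<bar> < d"
          using approx[of ?A d] d by auto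
        have "y \<in> span ?A" by (auto intro: span_base)
        then have "T (c *\<^sub>R y) = c *\<^sub>R T y" "T y \<in> X"
          using T unfolding local_almost_isometry_def linear_map_on_def by blast+
        then have "f (T (c *\<^sub>R y)) = c * f (T y)"
          using linear_map_on_dual(2)[OF f] by simp
        moreover have "\<bar>c * f (T y) - c * \<Phi> f y\<bar> \<le> \<bar>c\<bar> * d"
          using close by (simp add: abs_mult mult_left_mono flip: right_diff_distrib)
        ultimately show ?thesis using close d by (auto simp: algebra_simps)
      qed
      then show ?thesis by (rule real_eq_if_arbitrarily_close)
    qed
    obtain C where C: "C > 0" "\<And>x. x \<in> X \<Longrightarrow> \<bar>f x\<bar> \<le> C * norm x"
      using dual_on_bounded[OF f sub] by blast
    have "norm (\<Phi> f y) \<le> norm y * (2 * C)" for y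
    proof -
      have "\<bar>\<Phi> f y\<bar> \<le> 2 * C * norm y + \<epsilon>" if "\<epsilon> > 0" for \<epsilon>
      proof -
        obtain T where T: "local_almost_isometry X (span {y}) (min 1 \<epsilon>) T"
          and close: "\<bar>f (T y) - \<Phi> f y\<bar> < min 1 \<epsilon>"
          using approx[of "{y}" "min 1 \<epsilon>"] \<open>\<epsilon> > 0\<close> by auto
        have TX: "T y \<in> X" and "norm (T y) \<le> (1 + min 1 \<epsilon>) * norm y"
          using T by (auto simp: local_almost_isometry_def span_base)
        moreover have "(1 + min 1 \<epsilon>) * norm y \<le> 2 * norm y" by (intro mult_right_mono) auto
        ultimately have "C * norm (T y) \<le> C * (2 * norm y)"
          using C(1) by (intro mult_left_mono) auto
        then show ?thesis using C(2)[OF TX] close by auto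
      qed
      then have "\<bar>\<Phi> f y\<bar> \<le> 2 * C * norm y" by (rule field_le_epsilon)
      then show ?thesis by (simp add: mult.commute)
    qed
    then have "bounded_linear (\<Phi> f)"
      using add scale by (intro bounded_linear_intro) auto
    then show "\<Phi> f \<in> dual_on UNIV" by (simp add: dual_on_UNIV)
  qed
  show ?thesis
    by (intro exI[of _ \<Phi>] conjI ballI allI impI dual ext \<Phi>)
qed

section \<open>Transfer of the diameter 2 property\<close>

text \<open>Dividing by \<open>1 + \<epsilon>\<close> brings the images of points of the ball back into the ball.  It costs
  another factor \<open>1 + \<epsilon>\<close> in the distance and at most \<open>C * \<epsilon>\<close> in the value of a functional of
  norm at most \<open>C\<close>.\<close>

lemma local_almost_isometry_rescaled:
  assumes T: "local_almost_isometry X (span A) \<epsilon> T" and X: "subspace X" and \<epsilon>: "\<epsilon> > 0"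
    and y: "y \<in> A" "norm y \<le> 1"
  shows "T y /\<^sub>R (1 + \<epsilon>) \<in> X \<inter> cball 0 1"
    and "z \<in> A \<Longrightarrow> dist (T y /\<^sub>R (1 + \<epsilon>)) (T z /\<^sub>R (1 + \<epsilon>)) \<ge> dist y z / (1 + \<epsilon>)\<^sup>2"
    and "\<lbrakk>f \<in> dual_on X; C \<ge> 0; \<And>x. x \<in> X \<Longrightarrow> \<bar>f x\<bar> \<le> C * norm x\<rbrakk> \<Longrightarrow>
           \<bar>f (T y /\<^sub>R (1 + \<epsilon>)) - f (T y)\<bar> \<le> C * \<epsilon>"
proof -
  let ?x = "T y /\<^sub>R (1 + \<epsilon>)"
  have yE: "y \<in> span A" using y by (simp add: span_base)
  then have TX: "T y \<in> X" and le: "norm (T y) \<le> (1 + \<epsilon>) * norm y"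
    using T by (auto simp: local_almost_isometry_def)
  have "norm (T y) \<le> 1 + \<epsilon>"
    using order_trans[OF le mult_left_mono[OF y(2), of "1 + \<epsilon>"]] \<epsilon> by simp
  then have x1: "norm ?x \<le> 1" using \<epsilon> by (simp add: field_simps)
  have xX: "?x \<in> X" using TX X by (simp add: subspace_scale)
  from x1 xX show "?x \<in> X \<inter> cball 0 1" by simp
  show "dist ?x (T z /\<^sub>R (1 + \<epsilon>)) \<ge> dist y z / (1 + \<epsilon>)\<^sup>2" if z: "z \<in> A"
  proof -
    have zE: "z \<in> span A" using z by (simp add: span_base)
    have lin: "linear_map_on (span A) T" using T by (simp add: local_almost_isometry_def)
    have "T (y + (-1) *\<^sub>R z) = T y + T ((-1) *\<^sub>R z)" "T ((-1) *\<^sub>R z) = (-1) *\<^sub>R T z"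
      using lin yE zE span_scale[OF zE, of "-1"] unfolding linear_map_on_def by blast+
    then have diff: "T (y - z) = T y - T z" by simp
    have "inverse (1 + \<epsilon>) * norm (y - z) \<le> norm (T (y - z))"
      using T span_diff[OF yE zE] by (simp add: local_almost_isometry_def)
    then have "inverse (1 + \<epsilon>) * (inverse (1 + \<epsilon>) * norm (y - z)) \<le> inverse (1 + \<epsilon>) * norm (T y - T z)"
      using \<epsilon> by (intro mult_left_mono) (auto simp: diff)
    moreover have "dist ?x (T z /\<^sub>R (1 + \<epsilon>)) = inverse (1 + \<epsilon>) * norm (T y - T z)"
      using \<epsilon> by (simp add: dist_norm flip: scaleR_diff_right)
    ultimately show ?thesis
      by (simp add: dist_norm power2_eq_square divide_inverse mult_ac)
  qed
  show "\<bar>f ?x - f (T y)\<bar> \<le> C * \<epsilon>"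
    if f: "f \<in> dual_on X" and C: "C \<ge> 0" "\<And>x. x \<in> X \<Longrightarrow> \<bar>f x\<bar> \<le> C * norm x"
  proof -
    have "f (T y) = f ((1 + \<epsilon>) *\<^sub>R ?x)" using \<epsilon> by simp
    then have "f (T y) = (1 + \<epsilon>) * f ?x" using linear_map_on_dual(2)[OF f xX] by metis
    then have "\<bar>f ?x - f (T y)\<bar> = \<epsilon> * \<bar>f ?x\<bar>"
      using \<epsilon> by (simp add: algebra_simps abs_mult)
    also have "\<dots> \<le> \<epsilon> * C"
      using C(2)[OF xX] x1 C(1) \<epsilon> mult_left_mono[OF x1, of C] by (intro mult_left_mono) auto
    finally show ?thesis by (simp add: mult.commute)
  qed
qed

lemma diameter_2_property_far_points:
  assumes "diameter_2_property Z" "openin (weak_topology_on Z) V" "x \<in> V" "x \<in> cball 0 1" "\<eta> > 0"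
  obtains y z where "y \<in> V" "z \<in> V" "norm y \<le> 1" "norm z \<le> 1" "dist y z > 2 - \<eta>"
proof -
  let ?W = "V \<inter> (Z \<inter> cball 0 1)"
  have "V \<subseteq> Z" using openin_subset[OF assms(2)] by (simp add: topspace_weak_topology_on)
  then have "?W \<noteq> {}" using assms(3,4) by blast
  moreover have "openin (subtopology (weak_topology_on Z) (Z \<inter> cball 0 1)) ?W"
    using assms(2) by (auto simp: openin_subtopology)
  ultimately have diam: "diameter ?W = 2"
    using assms(1) unfolding diameter_2_property_def by blast
  have "bounded ?W" using bounded_cball[of "0 :: 'a" 1] by (rule bounded_subset) blast
  moreover have "0 < max 1 (2 - \<eta>)" "max 1 (2 - \<eta>) < diameter ?W" using assms(5) diam by auto
  ultimately obtain y z where "y \<in> ?W" "z \<in> ?W" "max 1 (2 - \<eta>) < dist y z"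
    using diameter_lower_bounded by metis
  then show thesis by (intro that[of y z]) auto
qed

lemma diameter_2_propertyI:
  assumes "\<And>V x \<eta>. \<lbrakk>openin (weak_topology_on Z) V; x \<in> V; x \<in> Z \<inter> cball 0 1; \<eta> > 0\<rbrakk> \<Longrightarrow>
    \<exists>y z. y \<in> V \<inter> (Z \<inter> cball 0 1) \<and> z \<in> V \<inter> (Z \<inter> cball 0 1) \<and> dist y z \<ge> 2 - \<eta>"
  shows "diameter_2_property Z"
  unfolding diameter_2_property_def
proof (intro allI impI, elim conjE)
  fix W assume "openin (subtopology (weak_topology_on Z) (Z \<inter> cball 0 1)) W" and ne: "W \<noteq> {}"
  then obtain V where V: "openin (weak_topology_on Z) V" "W = V \<inter> (Z \<inter> cball 0 1)"
    by (auto simp: openin_subtopology)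
  obtain x where x: "x \<in> W" using ne by blast
  have "bounded W" using bounded_cball[of "0 :: 'a" 1] by (rule bounded_subset) (use V in blast)
  have "2 \<le> diameter W + \<eta>" if \<eta>: "\<eta> > 0" for \<eta>
  proof -
    obtain y z where "y \<in> W" "z \<in> W" "dist y z \<ge> 2 - \<eta>"
      using assms[OF V(1), of x \<eta>] x V(2) \<eta> by blast
    then show ?thesis using diameter_bounded_bound[OF \<open>bounded W\<close>, of y z] by linarith
  qed
  then have "2 \<le> diameter W" by (rule field_le_epsilon)
  moreover have "diameter W \<le> 2"
  proof (rule diameter_le)
    show "norm (y - z) \<le> 2" if "y \<in> W" "z \<in> W" for y z
      using that V(2) norm_triangle_ineq4[of y z] by auto
  qed (use ne in auto)
  ultimately show "diameter W = 2" by simp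
qed

theorem proposition3p2:
  fixes X :: "'a::banach set"
  assumes "closed X"
    and "ai_ideal X"
    and "diameter_2_property (UNIV :: 'a set)"
  shows "diameter_2_property X"
proof (rule diameter_2_propertyI)
  have sub: "subspace X" using assms(2) by (simp add: ai_ideal_def)
  fix V x0 and \<eta> :: real
  assume V: "openin (weak_topology_on X) V" "x0 \<in> V" and x0: "x0 \<in> X \<inter> cball 0 1" and \<eta>: "\<eta> > 0"
  obtain F \<delta> where F: "finite F" "F \<subseteq> dual_on X" and \<delta>: "\<delta> > 0"
    and FV: "{z \<in> X. \<forall>f\<in>F. \<bar>f z - f x0\<bar> < \<delta>} \<subseteq> V"
    using weak_topology_on_basic_neighbourhood[OF V] .
  obtain C where C: "C > 0" "\<And>f x. f \<in> F \<Longrightarrow> x \<in> X \<Longrightarrow> \<bar>f x\<bar> \<le> C * norm x"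
    using dual_on_uniformly_bounded[OF F sub] by blast
  obtain \<Phi> where dual: "\<forall>f\<in>dual_on X. \<Phi> f \<in> dual_on UNIV \<and> (\<forall>x\<in>X. \<Phi> f x = f x)"
    and approx: "\<forall>A F. \<forall>\<epsilon>>0. finite A \<longrightarrow> finite F \<longrightarrow> F \<subseteq> dual_on X \<longrightarrow>
       (\<exists>T. local_almost_isometry X (span A) \<epsilon> T \<and> (\<forall>f\<in>F. \<forall>y\<in>A. \<bar>f (T y) - \<Phi> f y\<bar> < \<epsilon>))"
    using ai_ideal_pullback[OF assms(2)] by (elim exE conjE)
  define V' where "V' = {y. \<forall>f\<in>F. \<bar>\<Phi> f y - f x0\<bar> < \<delta> / 2}"
  have at_x0: "\<Phi> f x0 = f x0" if "f \<in> F" for f using dual F(2) x0 that by blast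
  have "V' = {y \<in> UNIV. \<forall>h\<in>\<Phi> ` F. \<bar>h y - h x0\<bar> < \<delta> / 2}"
    unfolding V'_def by (auto simp: at_x0)
  moreover have "\<Phi> ` F \<subseteq> dual_on UNIV" using dual F(2) by blast
  ultimately have "openin (weak_topology_on UNIV) V'"
    using openin_weak_topology_on_basic[of "\<Phi> ` F" UNIV "\<lambda>h. h x0" "\<delta> / 2"] F(1) by auto
  moreover have "x0 \<in> V'" using \<delta> by (simp add: V'_def at_x0)
  ultimately obtain y z where yz: "y \<in> V'" "z \<in> V'" "norm y \<le> 1" "norm z \<le> 1" "dist y z > 2 - \<eta> / 2"
    using diameter_2_property_far_points[OF assms(3), of V' x0 "\<eta> / 2"] x0 \<eta> by auto
  \<comment> \<open>The first bound keeps the loss \<open>\<epsilon> + C * \<epsilon>\<close> in the functionals within \<open>\<delta> / 2\<close>, the second one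
      the loss \<open>4 * \<epsilon>\<close> in the distance within \<open>\<eta> / 2\<close>.\<close>
  define \<epsilon> where "\<epsilon> = min (\<delta> / (2 * (1 + C))) (\<eta> / 8)"
  have \<epsilon>: "\<epsilon> > 0" using \<delta> \<eta> C(1) by (simp add: \<epsilon>_def)
  have "\<epsilon> \<le> \<delta> / (2 * (1 + C))" by (simp add: \<epsilon>_def)
  then have \<epsilon>_func: "\<epsilon> + C * \<epsilon> \<le> \<delta> / 2" using C(1) by (simp add: field_simps)
  obtain T where T: "local_almost_isometry X (span {y, z}) \<epsilon> T"
    and close: "\<forall>f\<in>F. \<forall>v\<in>{y, z}. \<bar>f (T v) - \<Phi> f v\<bar> < \<epsilon>"
    using approx[rule_format, OF \<epsilon>, of "{y, z}" F] F by auto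
  note rescaled = local_almost_isometry_rescaled[OF T sub \<epsilon>]
  have mem: "T v /\<^sub>R (1 + \<epsilon>) \<in> V \<inter> (X \<inter> cball 0 1)" if v: "v \<in> {y, z}" for v
  proof -
    have v1: "norm v \<le> 1" and vV: "v \<in> V'" using v yz by auto
    have "\<bar>f (T v /\<^sub>R (1 + \<epsilon>)) - f x0\<bar> < \<delta>" if f: "f \<in> F" for f
    proof -
      have "\<bar>f (T v /\<^sub>R (1 + \<epsilon>)) - f (T v)\<bar> \<le> C * \<epsilon>"
        using F(2) f C by (intro rescaled(3)[OF v v1]) auto
      moreover have "\<bar>f (T v) - \<Phi> f v\<bar> < \<epsilon>" using close f v by blast
      moreover have "\<bar>\<Phi> f v - f x0\<bar> < \<delta> / 2" using vV f by (simp add: V'_def)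
      ultimately show ?thesis using \<epsilon>_func by linarith
    qed
    then show ?thesis using FV rescaled(1)[OF v v1] by blast
  qed
  have "2 - \<eta> \<le> dist (T y /\<^sub>R (1 + \<epsilon>)) (T z /\<^sub>R (1 + \<epsilon>))"
  proof -
    let ?r = "1 / (1 + \<epsilon>)\<^sup>2"
    have "(1 - 2 * \<epsilon>) * (1 + \<epsilon>)\<^sup>2 = 1 - \<epsilon>\<^sup>2 * (3 + 2 * \<epsilon>)"
      by (simp add: power2_eq_square algebra_simps)
    then have "(1 - 2 * \<epsilon>) * (1 + \<epsilon>)\<^sup>2 \<le> 1" using \<epsilon> by simp
    then have r: "1 - 2 * \<epsilon> \<le> ?r" "0 \<le> ?r" using \<epsilon> by (auto simp: pos_le_divide_eq)
    have "dist y z \<le> 2" using yz(3,4) norm_triangle_ineq4[of y z] by (simp add: dist_norm)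
    then have "2 * \<epsilon> * dist y z \<le> 2 * \<epsilon> * 2" using \<epsilon> by (intro mult_left_mono) auto
    moreover have "(1 - 2 * \<epsilon>) * dist y z \<le> ?r * dist y z" using r by (intro mult_right_mono) auto
    moreover have "\<epsilon> \<le> \<eta> / 8" unfolding \<epsilon>_def by (rule min.cobounded2)
    ultimately have "2 - \<eta> \<le> ?r * dist y z" using yz(5) by (simp add: left_diff_distrib)
    then show ?thesis using rescaled(2)[of y z] yz(3) by simp
  qed
  with mem show "\<exists>y z. y \<in> V \<inter> (X \<inter> cball 0 1) \<and> z \<in> V \<inter> (X \<inter> cball 0 1) \<and> dist y z \<ge> 2 - \<eta>"
    by blast
qed

end
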